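(* Let $\Gamma$ be a unimodular Gaussian lattice of rank $2g$ over $\mathbb{Z}$. The map $q\mapsto Q_q$ is an affine isomorphism of $\mathcal{Q}_e^{(i)}$ onto $\mathcal{Q}_b$ (both being affine spaces over the $\mathbb{F}_2$-vector space $A_i$).
   Context: A Gaussian lattice is a free finitely generated $\mathbb{Z}[i]$-module $\Gamma$ with a positive (definite) hermitian form $H:\Gamma\times\Gamma\to\mathbb{Z}[i]$, $\mathbb{C}$-linear in the second variable. Write $H=S+iE$ with $S,E$ $\mathbb{Z}$-valued; $S$ is symmetric, $E$ is skew-symmetric, $S$ and $E$ are invariant under multiplication by $i$, and $E(x,y)=S(ix,y)$. $\Gamma$ is unimodular if $\det S=\det E=(\det H)^2=1$. Let $A_2=\Gamma/2\Gamma$, a free module of rank $g$ over $\mathbb{F}_2[i]=\mathbb{F}_2[\varepsilon]$, where $\varepsilon=1+i$ and $\varepsilon^2=0$. The subgroup of $i$-invariant elements of $A_2$ is $A_i=\operatorname{Ker}\varepsilon=\varepsilon A_2$, an $\mathbb{F}_2$-vector space of dimension $g$. Let $e:A_2\times A_2\to\mathbb{F}_2$ be the symplectic form induced by $E$, and $Q:A_2\to\mathbb{Z}/4$ the map induced by $x\mapsto S(x,x)$. The subspace $A_i$ is Lagrangian for $e$. For a non-degenerate symmetric bilinear form $b$ on a finite-dimensional $\mathbb{F}_2$-vector space $V$, a quadratic form associated to $b$ is a function $q:V\to\mathbb{Z}/4$ with $q(x+y)=q(x)+q(y)+2b(x,y)$ for $x,y\in V$, where multiplication by 2 stands for the isomorphism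 $\mathbb{Z}/2\cong2\mathbb{Z}/4\mathbb{Z}\subset\mathbb{Z}/4$. The set $\mathcal{Q}_b$ of these is an affine space over $V$, with action $(\alpha+q)(x)=q(x)+2b(\alpha,x)$ for $\alpha,x\in V$. Let $\mathcal{Q}_e^{(i)}$ be the set of quadratic forms $q$ on $A_2$ associated to $e$ that are $i$-invariant, i.e. $q(i\alpha)=q(\alpha)$ for all $\alpha\in A_2$; it is an affine subspace of $\mathcal{Q}_e$ with direction $A_i$ (action $(\alpha+q)(x)=q(x)+2e(\alpha,x)$ for $\alpha\in A_i$, $x\in A_2$). On $A_i$ let $b$ be the non-degenerate symmetric bilinear form defined by $b(\varepsilon\alpha,\varepsilon\beta)=e(\alpha,\varepsilon\beta)$ for $\alpha,\beta\in A_2$. For $q\in\mathcal{Q}_e^{(i)}$, let $Q_q\in\mathcal{Q}_b$ be the quadratic form on $A_i$ defined by $Q_q(\varepsilon\alpha)=q(\alpha)-Q(\alpha)$ for $\alpha\in A_2$ (these formulas are well defined). *)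

theory Defs
  imports
    "HOL-Library.Z2"
    "HOL-Library.Numeral_Type"
    "HOL-Library.FuncSet"
    "Jordan_Normal_Form.Determinant"
begin

section \<open>The Gaussian integers\<close>

datatype gint = GInt (gre: int) (gim: int)

lemma gint_eq_iff: "z = w \<longleftrightarrow> gre z = gre w \<and> gim z = gim w"
  by (cases z; cases w) simp

instantiation gint :: comm_ring_1
begin

definition zero_gint :: gint where "0 = GInt 0 0"
definition one_gint :: gint where "1 = GInt 1 0"
definition plus_gint :: "gint \<Rightarrow> gint \<Rightarrow> gint"
  where "z + w = GInt (gre z + gre w) (gim z + gim w)"
definition uminus_gint :: "gint \<Rightarrow> gint"
  where "- z = GInt (- gre z) (- gim z)"
definition minus_gint :: "gint \<Rightarrow> gint \<Rightarrow> gint"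
  where "z - w = GInt (gre z - gre w) (gim z - gim w)"
definition times_gint :: "gint \<Rightarrow> gint \<Rightarrow> gint"
  where "z * w = GInt (gre z * gre w - gim z * gim w) (gre z * gim w + gim z * gre w)"

instance
  by standard
    (auto simp: gint_eq_iff zero_gint_def one_gint_def plus_gint_def uminus_gint_def
      minus_gint_def times_gint_def algebra_simps)

end

lemma gint_simps [simp]:
  "gre 0 = 0" "gim 0 = 0" "gre 1 = 1" "gim 1 = 0"
  "gre (z + w) = gre z + gre w" "gim (z + w) = gim z + gim w"
  "gre (- z) = - gre z" "gim (- z) = - gim z"
  "gre (z - w) = gre z - gre w" "gim (z - w) = gim z - gim w"
  "gre (z * w) = gre z * gre w - gim z * gim w"
  "gim (z * w) = gre z * gim w + gim z * gre w"
  by (simp_all add: zero_gint_def one_gint_def plus_gint_def uminus_gint_def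
      minus_gint_def times_gint_def)

lemma gint_of_int [simp]: "gre (of_int n) = n" "gim (of_int n) = 0"
proof -
  have nat: "gre (of_nat m) = int m \<and> gim (of_nat m) = 0" for m
    by (induction m) simp_all
  show "gre (of_int n) = n" "gim (of_int n) = 0"
    by (cases n rule: int_diff_cases; simp add: nat)+
qed

lemma gint_numeral [simp]: "gre (numeral n) = numeral n" "gim (numeral n) = 0"
  using gint_of_int [of "numeral n"] by simp_all

definition gi :: gint where "gi = GInt 0 1"

definition gcnj :: "gint \<Rightarrow> gint" where "gcnj z = GInt (gre z) (- gim z)"

lemma gi_simps [simp]: "gre gi = 0" "gim gi = 1"
  by (simp_all add: gi_def)

lemma gcnj_simps [simp]: "gre (gcnj z) = gre z" "gim (gcnj z) = - gim z"
  by (simp_all add: gcnj_def)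

section \<open>Gaussian lattices\<close>

text \<open>
  The lattice is a whole type, with its \<open>\<int>[i]\<close>-module structure given by \<open>scale\<close>.  The locale
  \<open>module\<close> meant here is the type-class based one from \<open>HOL.Modules\<close>, not that of \<open>HOL-Algebra\<close>.
\<close>

definition is_basis :: "('r::comm_ring_1 \<Rightarrow> 'a::ab_group_add \<Rightarrow> 'a) \<Rightarrow> 'a list \<Rightarrow> bool" where
  "is_basis sc bs \<longleftrightarrow> distinct bs \<and>
     \<not> Modules.module.dependent sc (set bs) \<and> Modules.module.span sc (set bs) = UNIV"

definition int_scale :: "(gint \<Rightarrow> 'a::ab_group_add \<Rightarrow> 'a) \<Rightarrow> int \<Rightarrow> 'a \<Rightarrow> 'a" where
  "int_scale scale n x = scale (of_int n) x"

locale gaussian_lattice = Modules.module scale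
  for scale :: "gint \<Rightarrow> 'a::ab_group_add \<Rightarrow> 'a" +
  fixes H :: "'a \<Rightarrow> 'a \<Rightarrow> gint"
  assumes free_fin_gen: "\<exists>bs. is_basis scale bs"
    and add_right: "H x (y + z) = H x y + H x z"
    and scale_right: "H x (scale c y) = c * H x y"
    and hermitian: "H y x = gcnj (H x y)"
    and positive_definite: "x \<noteq> 0 \<Longrightarrow> gre (H x x) > 0"

definition form_S :: "('a \<Rightarrow> 'a \<Rightarrow> gint) \<Rightarrow> 'a \<Rightarrow> 'a \<Rightarrow> int" where
  "form_S H x y = gre (H x y)"

definition form_E :: "('a \<Rightarrow> 'a \<Rightarrow> gint) \<Rightarrow> 'a \<Rightarrow> 'a \<Rightarrow> int" where
  "form_E H x y = gim (H x y)"

definition gram :: "('a \<Rightarrow> 'a \<Rightarrow> 'r) \<Rightarrow> 'a list \<Rightarrow> 'r mat" where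
  "gram f bs = mat (length bs) (length bs) (\<lambda>(i, j). f (bs ! i) (bs ! j))"

definition has_int_rank :: "(gint \<Rightarrow> 'a::ab_group_add \<Rightarrow> 'a) \<Rightarrow> nat \<Rightarrow> bool" where
  "has_int_rank scale n \<longleftrightarrow> (\<exists>bs. is_basis (int_scale scale) bs \<and> length bs = n)"

text \<open>
  The determinants of \<open>S\<close> and \<open>E\<close> refer to a \<open>\<int>\<close>-basis, that of \<open>H\<close> to a \<open>\<int>[i]\<close>-basis; none of
  them depends on the choice of the basis, since a change of basis multiplies them by
  \<open>u\<^sup>2 = 1\<close> for a unit \<open>u\<close> of \<open>\<int>\<close>, respectively by the norm of a unit of \<open>\<int>[i]\<close>.
\<close>

definition unimodular :: "(gint \<Rightarrow> 'a::ab_group_add \<Rightarrow> 'a) \<Rightarrow> ('a \<Rightarrow> 'a \<Rightarrow> gint) \<Rightarrow> bool" where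
  "unimodular scale H \<longleftrightarrow>
     (\<exists>bs. is_basis (int_scale scale) bs \<and> det (gram (form_S H) bs) = 1 \<and>
        det (gram (form_E H) bs) = 1) \<and>
     (\<exists>cs. is_basis scale cs \<and> (det (gram H cs))\<^sup>2 = 1)"

section \<open>The group \<open>A\<^sub>2 = \<Gamma> / 2\<Gamma>\<close> and its forms\<close>

definition cong2 :: "'a::ab_group_add \<Rightarrow> 'a \<Rightarrow> bool" where
  "cong2 x y \<longleftrightarrow> (\<exists>z. x - y = z + z)"

lemma cong2_refl: "cong2 x x"
  unfolding cong2_def by (rule exI [of _ 0]) simp

lemma cong2_sym: "cong2 x y \<Longrightarrow> cong2 y x"
proof -
  assume "cong2 x y"
  then obtain z where "x - y = z + z" by (auto simp: cong2_def)
  then have "y - x = (- z) + (- z)" by (metis minus_add_distrib minus_diff_eq)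
  then show ?thesis unfolding cong2_def by blast
qed

lemma cong2_add: "cong2 x x' \<Longrightarrow> cong2 y y' \<Longrightarrow> cong2 (x + y) (x' + y')"
proof -
  assume "cong2 x x'" "cong2 y y'"
  then obtain z w where "x - x' = z + z" "y - y' = w + w" by (auto simp: cong2_def)
  then have "(x + y) - (x' + y') = (z + w) + (z + w)" by (simp add: algebra_simps)
  then show ?thesis by (auto simp: cong2_def)
qed

lemma cong2_minus: "cong2 x x' \<Longrightarrow> cong2 (- x) (- x')"
  using cong2_sym by (fastforce simp: cong2_def)

lemma cong2_trans: "cong2 x y \<Longrightarrow> cong2 y z \<Longrightarrow> cong2 x z"
  using cong2_add [of x y y z] by (simp add: cong2_def)

lemma equivp_cong2: "equivp cong2"
  by (intro equivpI reflpI sympI transpI) (blast intro: cong2_refl cong2_sym cong2_trans)+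

quotient_type (overloaded) 'a mod2 = "'a::ab_group_add" / cong2
  morphisms rep2 proj2
  by (rule equivp_cong2)

instantiation mod2 :: (ab_group_add) ab_group_add
begin

lift_definition zero_mod2 :: "'a mod2" is 0 .
lift_definition plus_mod2 :: "'a mod2 \<Rightarrow> 'a mod2 \<Rightarrow> 'a mod2" is "(+)"
  by (rule cong2_add)
lift_definition uminus_mod2 :: "'a mod2 \<Rightarrow> 'a mod2" is uminus
  by (rule cong2_minus)
lift_definition minus_mod2 :: "'a mod2 \<Rightarrow> 'a mod2 \<Rightarrow> 'a mod2" is "(-)"
  using cong2_add cong2_minus by fastforce

instance
  by standard (transfer, simp add: algebra_simps cong2_refl)+

end

text \<open>
  The structures induced on the quotient are defined through representatives; for a Gaussian
  lattice they do not depend on them (\<open>scale2_proj\<close>, \<open>form_e_proj\<close>, \<open>form_Q_proj\<close> below).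
\<close>

definition scale2 :: "(gint \<Rightarrow> 'a::ab_group_add \<Rightarrow> 'a) \<Rightarrow> gint \<Rightarrow> 'a mod2 \<Rightarrow> 'a mod2" where
  "scale2 scale c \<alpha> = proj2 (scale c (rep2 \<alpha>))"

abbreviation eps :: "(gint \<Rightarrow> 'a::ab_group_add \<Rightarrow> 'a) \<Rightarrow> 'a mod2 \<Rightarrow> 'a mod2" where
  "eps scale \<equiv> scale2 scale (1 + gi)"

definition form_e :: "('a::ab_group_add \<Rightarrow> 'a \<Rightarrow> gint) \<Rightarrow> 'a mod2 \<Rightarrow> 'a mod2 \<Rightarrow> bit" where
  "form_e H \<alpha> \<beta> = of_int (form_E H (rep2 \<alpha>) (rep2 \<beta>))"

definition form_Q :: "('a::ab_group_add \<Rightarrow> 'a \<Rightarrow> gint) \<Rightarrow> 'a mod2 \<Rightarrow> 4" where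
  "form_Q H \<alpha> = of_int (form_S H (rep2 \<alpha>) (rep2 \<alpha>))"

definition A_i :: "(gint \<Rightarrow> 'a::ab_group_add \<Rightarrow> 'a) \<Rightarrow> 'a mod2 set" where
  "A_i scale = {\<alpha>. scale2 scale gi \<alpha> = \<alpha>}"

section \<open>Quadratic forms with values in \<open>\<int>/4\<close> and affine spaces over \<open>\<bbbF>\<^sub>2\<close>\<close>

text \<open>The embedding \<open>\<int>/2 \<cong> 2\<int>/4\<int> \<subset> \<int>/4\<close>.\<close>

definition two_times :: "bit \<Rightarrow> 4" where
  "two_times c = (if c = 0 then 0 else 2)"

text \<open>
  Functions on a subgroup \<open>V\<close> are represented by extensional functions; for \<open>V = UNIV\<close> this is no
  restriction.
\<close>

definition quad_forms :: "'v::ab_group_add set \<Rightarrow> ('v \<Rightarrow> 'v \<Rightarrow> bit) \<Rightarrow> ('v \<Rightarrow> 4) set" where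
  "quad_forms V b = {q \<in> extensional V.
     \<forall>x\<in>V. \<forall>y\<in>V. q (x + y) = q x + q y + two_times (b x y)}"

definition qf_act ::
    "'v::ab_group_add set \<Rightarrow> ('v \<Rightarrow> 'v \<Rightarrow> bit) \<Rightarrow> 'v \<Rightarrow> ('v \<Rightarrow> 4) \<Rightarrow> ('v \<Rightarrow> 4)" where
  "qf_act V b \<alpha> q = restrict (\<lambda>x. q x + two_times (b \<alpha> x)) V"

text \<open>
  An \<open>\<bbbF>\<^sub>2\<close>-vector space is the same thing as an abelian group of exponent dividing 2.
\<close>

definition F2_space :: "'v::ab_group_add set \<Rightarrow> bool" where
  "F2_space V \<longleftrightarrow> 0 \<in> V \<and> (\<forall>x\<in>V. \<forall>y\<in>V. x + y \<in> V) \<and> (\<forall>x\<in>V. x + x = 0)"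

definition affine_space_over :: "'v::ab_group_add set \<Rightarrow> ('v \<Rightarrow> 'p \<Rightarrow> 'p) \<Rightarrow> 'p set \<Rightarrow> bool" where
  "affine_space_over V act X \<longleftrightarrow> F2_space V \<and> X \<noteq> {} \<and>
     (\<forall>v\<in>V. \<forall>x\<in>X. act v x \<in> X) \<and>
     (\<forall>x\<in>X. act 0 x = x) \<and>
     (\<forall>v\<in>V. \<forall>w\<in>V. \<forall>x\<in>X. act (v + w) x = act v (act w x)) \<and>
     (\<forall>x\<in>X. \<forall>y\<in>X. \<exists>!v. v \<in> V \<and> act v x = y)"

text \<open>Isomorphisms of affine spaces over the same \<open>V\<close>: the linear part is the identity of \<open>V\<close>.\<close>

definition affine_iso_over ::
    "'v::ab_group_add set \<Rightarrow> ('v \<Rightarrow> 'p \<Rightarrow> 'p) \<Rightarrow> 'p set \<Rightarrow> ('v \<Rightarrow> 'r \<Rightarrow> 'r) \<Rightarrow> 'r set \<Rightarrow>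
      ('p \<Rightarrow> 'r) \<Rightarrow> bool" where
  "affine_iso_over V act X act' Y f \<longleftrightarrow>
     affine_space_over V act X \<and> affine_space_over V act' Y \<and> bij_betw f X Y \<and>
     (\<forall>v\<in>V. \<forall>x\<in>X. f (act v x) = act' v (f x))"

section \<open>The form \<open>b\<close> on \<open>A\<^sub>i\<close> and the map \<open>q \<mapsto> Q\<^sub>q\<close>\<close>

definition inv_quad_forms ::
    "(gint \<Rightarrow> 'a::ab_group_add \<Rightarrow> 'a) \<Rightarrow> ('a \<Rightarrow> 'a \<Rightarrow> gint) \<Rightarrow> ('a mod2 \<Rightarrow> 4) set" where
  "inv_quad_forms scale H =
     {q \<in> quad_forms UNIV (form_e H). \<forall>\<alpha>. q (scale2 scale gi \<alpha>) = q \<alpha>}"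

text \<open>
  The descriptions below are legitimate by \<open>form_b_eps\<close> and \<open>Q_of_eps\<close>.
\<close>

definition form_b ::
    "(gint \<Rightarrow> 'a::ab_group_add \<Rightarrow> 'a) \<Rightarrow> ('a \<Rightarrow> 'a \<Rightarrow> gint) \<Rightarrow> 'a mod2 \<Rightarrow> 'a mod2 \<Rightarrow> bit" where
  "form_b scale H x y =
     (THE c. \<exists>\<alpha> \<beta>. x = eps scale \<alpha> \<and> y = eps scale \<beta> \<and> c = form_e H \<alpha> (eps scale \<beta>))"

definition Q_of ::
    "(gint \<Rightarrow> 'a::ab_group_add \<Rightarrow> 'a) \<Rightarrow> ('a \<Rightarrow> 'a \<Rightarrow> gint) \<Rightarrow> ('a mod2 \<Rightarrow> 4) \<Rightarrow> ('a mod2 \<Rightarrow> 4)" where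
  "Q_of scale H q =
     restrict (\<lambda>x. THE c. \<exists>\<alpha>. x = eps scale \<alpha> \<and> c = q \<alpha> - form_Q H \<alpha>) (A_i scale)"

section \<open>Well-definedness\<close>

lemma proj2_eq_iff: "proj2 x = proj2 y \<longleftrightarrow> cong2 x y"
  by (simp add: mod2.abs_eq_iff)

lemma proj2_rep2 [simp]: "proj2 (rep2 \<alpha>) = \<alpha>"
  by (rule Quotient3_abs_rep [OF Quotient3_mod2])

lemma cong2_rep2: "cong2 (rep2 (proj2 x)) x"
  by (simp flip: proj2_eq_iff)

lemma proj2_surj: obtains x where "\<alpha> = proj2 x"
  by (metis proj2_rep2)

lemma proj2_add: "proj2 (x + y) = proj2 x + proj2 y"
  by (simp add: plus_mod2.abs_eq)

lemma four_times: "4 * x = (0 :: 4)"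
proof -
  have "(4 :: 4) = 0" by simp
  then show ?thesis by (metis mult_zero_left)
qed

lemma proj2_diff: "proj2 (x - y) = proj2 x - proj2 y"
  by (simp add: minus_mod2.abs_eq)

lemma two_times_of_int: "two_times (of_int n) = of_int (2 * n)"
proof (cases "even n")
  case True
  then obtain k where "n = 2 * k" by blast
  moreover have "4 * (of_int k :: 4) = 0"
    by (rule four_times)
  ultimately show ?thesis by (simp add: two_times_def)
next
  case False
  then obtain k where "n = 2 * k + 1" by (rule oddE)
  moreover have "4 * (of_int k :: 4) = 0"
    by (rule four_times)
  ultimately show ?thesis by (simp add: two_times_def algebra_simps)
qed

context gaussian_lattice
begin

lemma H_add_left: "H (x + y) z = H x z + H y z"
  by (simp add: hermitian [of _ z] add_right gint_eq_iff)

lemma H_scale_left: "H (scale c x) y = gcnj c * H x y"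
  by (simp add: hermitian [of _ y] scale_right gint_eq_iff)

lemma H_self_real: "gim (H x x) = 0"
  using hermitian [of x x] by (simp add: gint_eq_iff)

lemma scale2_proj: "scale2 scale c (proj2 x) = proj2 (scale c x)"
proof -
  obtain z where "rep2 (proj2 x) - x = z + z"
    using cong2_rep2 [of x] by (auto simp: cong2_def)
  then have "scale c (rep2 (proj2 x)) - scale c x = scale c z + scale c z"
    by (metis scale_right_diff_distrib scale_right_distrib)
  then show ?thesis by (auto simp: scale2_def proj2_eq_iff cong2_def)
qed

lemma scale2_diff: "scale2 scale c (\<alpha> - \<beta>) = scale2 scale c \<alpha> - scale2 scale c \<beta>"
proof -
  obtain x y where "\<alpha> = proj2 x" "\<beta> = proj2 y" by (metis proj2_surj)
  then show ?thesis
    by (simp only: scale2_proj scale_right_diff_distrib flip: proj2_diff)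
qed

lemma rep2_projE:
  obtains z where "rep2 (proj2 x) = x + (z + z)"
  using cong2_rep2 [of x] by (metis cong2_def add.commute diff_add_cancel)

lemma form_e_proj: "form_e H (proj2 x) (proj2 y) = of_int (form_E H x y)"
proof -
  obtain z where z: "rep2 (proj2 x) = x + (z + z)" by (rule rep2_projE)
  obtain w where w: "rep2 (proj2 y) = y + (w + w)" by (rule rep2_projE)
  show ?thesis
    by (simp add: form_e_def form_E_def z w H_add_left add_right)
qed

lemma form_Q_proj: "form_Q H (proj2 x) = of_int (form_S H x x)"
proof -
  obtain z where z: "rep2 (proj2 x) = x + (z + z)" by (rule rep2_projE)
  have "gre (H z x) = gre (H x z)" by (metis hermitian gcnj_simps(1))
  then have "form_S H (rep2 (proj2 x)) (rep2 (proj2 x))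
      = form_S H x x + 4 * (gre (H x z) + gre (H z z))"
    by (simp add: form_S_def z H_add_left add_right)
  then show ?thesis by (simp add: form_Q_def four_times)
qed

lemma torsion_free:
  fixes x :: 'a
  assumes "x + x = 0"
  shows "x = 0"
proof (rule ccontr)
  assume "x \<noteq> 0"
  have "H x 0 = 0" using add_right [of x 0 0] by simp
  then have "H x x + H x x = 0" by (metis add_right assms)
  then have "gre (H x x) + gre (H x x) = 0" by (metis gint_simps(1,5))
  then show False using positive_definite [OF \<open>x \<noteq> 0\<close>] by simp
qed

lemma A_i_eq_ker: "A_i scale = {\<alpha>. eps scale \<alpha> = 0}"
proof -
  have "scale2 scale gi \<alpha> = \<alpha> \<longleftrightarrow> eps scale \<alpha> = 0" for \<alpha>
  proof -
    obtain x where x: "\<alpha> = proj2 x" by (rule proj2_surj)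
    have "proj2 x + proj2 x = 0"
      by (metis cong2_def diff_0_right proj2_add proj2_eq_iff zero_mod2_def)
    then have "proj2 x = - proj2 x" by (simp add: eq_neg_iff_add_eq_0)
    then show ?thesis
      unfolding x scale2_proj scale_left_distrib proj2_add scale_one
      by (metis add.commute eq_neg_iff_add_eq_0)
  qed
  then show ?thesis by (simp add: A_i_def)
qed

lemma A_i_eq_range: "A_i scale = range (eps scale)"
proof (intro subset_antisym subsetI)
  fix \<alpha> assume "\<alpha> \<in> A_i scale"
  moreover obtain x where x: "\<alpha> = proj2 x" by (rule proj2_surj)
  ultimately obtain y where y: "scale (1 + gi) x = y + y"
    by (auto simp: A_i_eq_ker scale2_proj zero_mod2_def proj2_eq_iff cong2_def)
  have "scale (1 - gi) (scale (1 + gi) x) = x + x"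
    by (simp add: scale_left_distrib [of 1 1, simplified, symmetric] gint_eq_iff
        arg_cong [where f = "\<lambda>c. scale c x"])
  then have "x + x = scale (1 - gi) y + scale (1 - gi) y"
    by (simp add: y scale_right_distrib)
  then have "(x - scale (1 - gi) y) + (x - scale (1 - gi) y) = 0"
    by (simp add: algebra_simps)
  then have "x - scale (1 - gi) y = 0" by (rule torsion_free)
  then have "x = scale (1 - gi) y" by simp
  also have "1 - gi = (1 + gi) * (- gi)" by (simp add: gint_eq_iff)
  finally have "x = scale ((1 + gi) * (- gi)) y" .
  then have "\<alpha> = eps scale (proj2 (scale (- gi) y))"
    by (simp only: x scale2_proj scale_scale)
  then show "\<alpha> \<in> range (eps scale)" by blast
next
  fix \<alpha> assume "\<alpha> \<in> range (eps scale)"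
  then obtain x where x: "\<alpha> = proj2 (scale (1 + gi) x)"
    by (metis (no_types) proj2_surj imageE scale2_proj)
  have "scale (1 + gi) (scale (1 + gi) x) = scale gi x + scale gi x"
    unfolding scale_scale scale_left_distrib [symmetric]
    by (rule arg_cong [where f = "\<lambda>c. scale c x"]) (simp add: gint_eq_iff)
  then show "\<alpha> \<in> A_i scale"
    by (auto simp: x A_i_eq_ker scale2_proj zero_mod2_def proj2_eq_iff cong2_def)
qed

lemma eps_eqE:
  assumes "eps scale \<alpha> = eps scale \<alpha>'"
  obtains \<gamma> where "\<alpha> = \<alpha>' + eps scale \<gamma>"
proof -
  have "eps scale (\<alpha> - \<alpha>') = 0"
    using assms by (simp add: scale2_diff)
  then have "\<alpha> - \<alpha>' \<in> range (eps scale)"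
    using A_i_eq_ker A_i_eq_range by auto
  then obtain \<gamma> where "\<alpha> - \<alpha>' = eps scale \<gamma>" by blast
  then have "\<alpha> = \<alpha>' + eps scale \<gamma>" by (metis add.commute diff_add_cancel)
  then show thesis by (rule that)
qed

lemma form_e_add_left: "form_e H (\<alpha> + \<beta>) \<gamma> = form_e H \<alpha> \<gamma> + form_e H \<beta> \<gamma>"
proof -
  obtain x y z where "\<alpha> = proj2 x" "\<beta> = proj2 y" "\<gamma> = proj2 z" by (metis proj2_surj)
  then show ?thesis
    by (simp only: form_e_proj flip: proj2_add) (simp add: form_E_def H_add_left)
qed

lemma form_e_eps_eps: "form_e H (eps scale \<alpha>) (eps scale \<beta>) = 0"
proof -
  obtain x y where xy: "\<alpha> = proj2 x" "\<beta> = proj2 y" by (metis proj2_surj)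
  have "form_E H (scale (1 + gi) x) (scale (1 + gi) y) = 2 * gim (H x y)"
    by (simp add: form_E_def H_scale_left scale_right del: scale_left_distrib)
  then show ?thesis by (simp add: xy scale2_proj form_e_proj)
qed

lemma form_b_eps: "form_b scale H (eps scale \<alpha>) (eps scale \<beta>) = form_e H \<alpha> (eps scale \<beta>)"
  unfolding form_b_def
proof (rule the_equality)
  fix c
  assume "\<exists>\<alpha>' \<beta>'. eps scale \<alpha> = eps scale \<alpha>' \<and> eps scale \<beta> = eps scale \<beta>' \<and>
    c = form_e H \<alpha>' (eps scale \<beta>')"
  then obtain \<alpha>' where "eps scale \<alpha> = eps scale \<alpha>'" "c = form_e H \<alpha>' (eps scale \<beta>)" by auto
  moreover from this(1) obtain \<gamma> where "\<alpha> = \<alpha>' + eps scale \<gamma>" by (rule eps_eqE)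
  ultimately show "c = form_e H \<alpha> (eps scale \<beta>)"
    by (simp add: form_e_add_left form_e_eps_eps)
qed blast

lemma inv_quad_form_eps:
  assumes "q \<in> inv_quad_forms scale H"
  shows "q (\<alpha> + eps scale \<gamma>) - form_Q H (\<alpha> + eps scale \<gamma>) = q \<alpha> - form_Q H \<alpha>"
proof -
  have add: "q (\<alpha> + \<beta>) = q \<alpha> + q \<beta> + two_times (form_e H \<alpha> \<beta>)"
    and inv: "q (scale2 scale gi \<alpha>) = q \<alpha>" for \<alpha> \<beta>
    using assms by (auto simp: inv_quad_forms_def quad_forms_def)
  obtain x z where x: "\<alpha> = proj2 x" and z: "\<gamma> = proj2 z" by (metis proj2_surj)
  define s where "s = gre (H z z)"
  have eps_z: "eps scale \<gamma> = proj2 z + proj2 (scale gi z)"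
    by (simp add: z scale2_proj scale_left_distrib proj2_add)
  have zero: "q 0 = 0"
    using add [of 0 0] form_e_proj [of 0 0] H_add_left [of 0 0 0]
    by (simp add: form_E_def two_times_def flip: zero_mod2_def)
  have "proj2 z + proj2 z = 0"
    by (metis cong2_def diff_0_right proj2_add proj2_eq_iff zero_mod2_def)
  then have "q (proj2 z) + q (proj2 z) = 0"
    using add [of "proj2 z" "proj2 z"] zero
    by (simp add: form_e_proj form_E_def H_self_real two_times_def)
  then have q_eps: "q (eps scale \<gamma>) = of_int (2 * s)"
    using inv [of "proj2 z"]
    by (simp add: eps_z add scale2_proj form_e_proj form_E_def two_times_of_int scale_right s_def
        del: of_int_mult)
  have *: "gre (H z x) = gre (H x z)" "gim (H z x) = - gim (H x z)"
    by (metis hermitian gcnj_simps)+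
  have "form_S H (x + scale (1 + gi) z) (x + scale (1 + gi) z)
      = form_S H x x + 2 * (gre (H x z) - gim (H x z)) + 2 * s"
    by (simp add: form_S_def H_add_left add_right H_scale_left scale_right * s_def H_self_real)
  then have Q: "form_Q H (\<alpha> + eps scale \<gamma>)
      = form_Q H \<alpha> + of_int (2 * (gre (H x z) - gim (H x z))) + of_int (2 * s)"
    unfolding x z scale2_proj proj2_add [symmetric] form_Q_proj by (simp only: of_int_add)
  have "form_E H x (scale (1 + gi) z) = gre (H x z) + gim (H x z)"
    by (simp add: form_E_def scale_right)
  then have "form_e H \<alpha> (eps scale \<gamma>) = of_int (gre (H x z) + gim (H x z))"
    by (simp only: x z scale2_proj form_e_proj)
  then have "two_times (form_e H \<alpha> (eps scale \<gamma>)) = of_int (2 * (gre (H x z) + gim (H x z)))"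
    by (simp only: two_times_of_int)
  also have "2 * (gre (H x z) + gim (H x z)) = 2 * (gre (H x z) - gim (H x z)) + 4 * gim (H x z)"
    by simp
  also have "of_int \<dots> = (of_int (2 * (gre (H x z) - gim (H x z))) :: 4)"
    by (simp only: of_int_add of_int_mult [of 4] of_int_numeral four_times add_0_right)
  finally have "q (\<alpha> + eps scale \<gamma>)
      = q \<alpha> + of_int (2 * s) + of_int (2 * (gre (H x z) - gim (H x z)))"
    by (simp only: add q_eps)
  then show ?thesis by (simp add: Q)
qed

lemma Q_of_eps:
  assumes "q \<in> inv_quad_forms scale H"
  shows "Q_of scale H q (eps scale \<alpha>) = q \<alpha> - form_Q H \<alpha>"
proof -
  have "(THE c. \<exists>\<alpha>'. eps scale \<alpha> = eps scale \<alpha>' \<and> c = q \<alpha>' - form_Q H \<alpha>') = q \<alpha> - form_Q H \<alpha>"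
  proof (rule the_equality)
    fix c
    assume "\<exists>\<alpha>'. eps scale \<alpha> = eps scale \<alpha>' \<and> c = q \<alpha>' - form_Q H \<alpha>'"
    then obtain \<alpha>' where "eps scale \<alpha> = eps scale \<alpha>'" "c = q \<alpha>' - form_Q H \<alpha>'" by blast
    moreover from this(1) obtain \<gamma> where "\<alpha> = \<alpha>' + eps scale \<gamma>" by (rule eps_eqE)
    ultimately show "c = q \<alpha> - form_Q H \<alpha>"
      by (simp add: inv_quad_form_eps [OF assms])
  qed blast
  then show ?thesis by (simp add: Q_of_def A_i_eq_range)
qed

end

end

theory Submission
  imports Defs
begin

text \<open>
  Both sets of quadratic forms are torsors under \<open>A\<^sub>i\<close>, and an equivariant map between torsors is
  automatically bijective (\<open>affine_iso_over_equivariant\<close>).  So three things have to be shown.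

  \<^item> \<open>Q\<^sub>q\<close> is a quadratic form for \<open>b\<close>.  Since \<open>S(x,y) = E(x,iy)\<close>, the defect of additivity of
    \<open>q - Q\<close> is \<open>2 e(\<alpha>,\<beta>) - 2 e(\<alpha>,i\<beta>) = 2 e(\<alpha>,\<epsilon>\<beta>) = 2 b(\<epsilon>\<alpha>,\<epsilon>\<beta>)\<close>.

  \<^item> The map is equivariant.  Multiplication by \<open>\<epsilon>\<close> is self-adjoint for \<open>e\<close>, whence
    \<open>b(\<alpha>,\<epsilon>\<xi>) = e(\<alpha>,\<xi>)\<close> for \<open>\<alpha>\<close> in \<open>A\<^sub>i\<close>: the translations by \<open>\<alpha>\<close> of \<open>q\<close> and of \<open>Q\<^sub>q\<close> agree.

  \<^item> The two sets are torsors.  Two quadratic forms with the same polarisation differ by twice a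
    linear form, so simple transitivity says that the bilinear form is perfect
    (\<open>affine_space_quad_forms\<close>).  For \<open>e\<close> this is unimodularity: a \<open>\<int>\<close>-basis of the lattice has a
    dual basis for \<open>E\<close>, given by the adjugate of the Gram matrix (\<open>dual_basis\<close>).  The same for \<open>b\<close>
    follows by composing linear forms on \<open>A\<^sub>i\<close> with \<open>\<epsilon>\<close> (\<open>form_b_represents\<close>).  As \<open>i\<close> is
    self-adjoint for \<open>e\<close>, translation by \<open>\<alpha>\<close> preserves \<open>i\<close>-invariance of a form exactly when
    \<open>i\<alpha> = \<alpha>\<close>.

  It remains to see that there are forms at all.  On any finite \<open>\<bbbF>\<^sub>2\<close>-space every symmetric
  bilinear form has a \<open>\<int>/4\<close>-valued quadratic form, built up one vector at a time
  (\<open>quad_forms_nonempty\<close>); this settles \<open>b\<close>.  A form \<open>p\<close> for \<open>b\<close> then yields the invariant form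
  \<open>\<alpha> \<mapsto> p(\<epsilon>\<alpha>) + Q(\<alpha>)\<close> for \<open>e\<close>, the inverse image of \<open>p\<close> under \<open>q \<mapsto> Q\<^sub>q\<close>.
\<close>

text \<open>
  These rules turn sums of bits into case distinctions, which hides the additivity of the forms.
\<close>

declare add_bit_eq_xor [simp del] mult_bit_eq_and [simp del]

section \<open>Affine spaces over \<open>\<bbbF>\<^sub>2\<close>\<close>

text \<open>
  A fixed point of a translation forces the translation to be zero, which gives injectivity; any
  point of the target is a translate of \<open>f x\<close> for one chosen \<open>x\<close>, which gives surjectivity.
\<close>

lemma affine_iso_over_equivariant:
  assumes X: "affine_space_over V act X" and Y: "affine_space_over V act' Y"
    and maps: "\<And>x. x \<in> X \<Longrightarrow> f x \<in> Y"
    and equivariant: "\<And>v x. v \<in> V \<Longrightarrow> x \<in> X \<Longrightarrow> f (act v x) = act' v (f x)"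
  shows "affine_iso_over V act X act' Y f"
proof -
  have zero: "0 \<in> V" and act0: "\<And>x. x \<in> X \<Longrightarrow> act 0 x = x" "\<And>y. y \<in> Y \<Longrightarrow> act' 0 y = y"
    using X Y by (auto simp: affine_space_over_def F2_space_def)
  have uniqueY: "v = w" if "v \<in> V" "w \<in> V" "y \<in> Y" "act' v y = act' w y" for v w y
  proof -
    have "act' w y \<in> Y" using Y that by (auto simp: affine_space_over_def)
    then have "\<exists>!u. u \<in> V \<and> act' u y = act' w y"
      using Y that by (auto simp: affine_space_over_def)
    then show ?thesis using that by blast
  qed
  have "inj_on f X"
  proof (rule inj_onI)
    fix x x' assume x: "x \<in> X" "x' \<in> X" "f x = f x'"
    then obtain v where v: "v \<in> V" "act v x = x'"
      using X unfolding affine_space_over_def by blast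
    then have "act' v (f x) = act' 0 (f x)"
      using equivariant [of v x] x maps act0 by auto
    then have "v = 0" using uniqueY v zero maps x by blast
    then show "x = x'" using v act0 x by auto
  qed
  moreover have "Y \<subseteq> f ` X"
  proof
    fix y assume y: "y \<in> Y"
    obtain x where x: "x \<in> X" using X by (auto simp: affine_space_over_def)
    obtain v where v: "v \<in> V" "act' v (f x) = y"
      using Y y maps [OF x] unfolding affine_space_over_def by blast
    then have "y = f (act v x)" using equivariant x by simp
    moreover have "act v x \<in> X" using X v x by (auto simp: affine_space_over_def)
    ultimately show "y \<in> f ` X" by blast
  qed
  ultimately have "bij_betw f X Y" using maps by (auto simp: bij_betw_def)
  then show ?thesis using X Y equivariant by (simp add: affine_iso_over_def)
qed

text \<open>
  Used to pass from all quadratic forms for \<open>e\<close> to the \<open>i\<close>-invariant ones: transitivity is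
  inherited because the translation between two points of \<open>Y\<close> must lie in \<open>W\<close>.
\<close>

lemma affine_subspace:
  assumes X: "affine_space_over V act X" and W: "F2_space W" "W \<subseteq> V"
    and Y: "Y \<subseteq> X" "Y \<noteq> {}"
    and dir: "\<And>v y. v \<in> V \<Longrightarrow> y \<in> Y \<Longrightarrow> act v y \<in> Y \<longleftrightarrow> v \<in> W"
  shows "affine_space_over W act Y"
  unfolding affine_space_over_def
proof (intro conjI ballI)
  fix x y assume xy: "x \<in> Y" "y \<in> Y"
  then have "\<exists>!v. v \<in> V \<and> act v x = y"
    using X Y unfolding affine_space_over_def by blast
  then show "\<exists>!v. v \<in> W \<and> act v x = y"
    using dir xy W by blast
next
  fix v w x assume "v \<in> W" "w \<in> W" "x \<in> Y"
  then show "act (v + w) x = act v (act w x)"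
    using X W Y unfolding affine_space_over_def by blast
next
  fix x assume "x \<in> Y"
  then show "act 0 x = x"
    using X Y unfolding affine_space_over_def by blast
qed (use W Y dir in auto)

section \<open>Quadratic forms with values in \<open>\<int>/4\<close>\<close>

lemma bit_add_eq_0_iff: "a + b = 0 \<longleftrightarrow> a = b" for a b :: bit
  by (cases a; cases b) simp_all

lemma two_times_0 [simp]: "two_times 0 = 0"
  by (simp add: two_times_def)

lemma two_times_1 [simp]: "two_times 1 = 2"
  by (simp add: two_times_def)

lemma two_times_add: "two_times (a + b) = two_times a + two_times b"
  by (cases a; cases b) simp_all

lemma two_times_double [simp]: "two_times a + two_times a = 0"
  by (cases a) simp_all

lemma two_times_eq_iff [simp]: "two_times a = two_times b \<longleftrightarrow> a = b"
  by (cases a; cases b) simp_all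

lemma two_torsion_Z4:
  fixes x :: 4
  assumes "x + x = 0"
  obtains c where "x = two_times c"
proof -
  obtain z where "x = of_int z" "0 \<le> z" "z < 4"
    by (cases x rule: bit0_cases) auto
  then have "z = 0 \<or> z = 1 \<or> z = 2 \<or> z = 3" by auto
  then have "x = 0 \<or> x = 1 \<or> x = 2 \<or> x = 3" using \<open>x = of_int z\<close> by auto
  then have "x = two_times 0 \<or> x = two_times 1" using assms by auto
  then show thesis using that by blast
qed

lemma quad_formsD:
  assumes "q \<in> quad_forms V b" "x \<in> V" "y \<in> V"
  shows "q (x + y) = q x + q y + two_times (b x y)"
  using assms by (simp add: quad_forms_def)

lemma quad_forms_outside:
  assumes "q \<in> quad_forms V b" "x \<notin> V"
  shows "q x = undefined"
  using assms extensional_arb [of q V x] by (simp add: quad_forms_def)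

text \<open>
  The polarisations cancel, so the difference is additive; as \<open>x + x = 0\<close>, its values are killed
  by 2 and hence of the form \<open>2 l(x)\<close>.
\<close>

lemma quad_forms_diff:
  assumes V: "F2_space V" and q: "q \<in> quad_forms V b" and q': "q' \<in> quad_forms V b"
  obtains l where "\<And>x. x \<in> V \<Longrightarrow> q' x = q x + two_times (l x)"
    and "\<And>x y. x \<in> V \<Longrightarrow> y \<in> V \<Longrightarrow> l (x + y) = l x + l y"
proof -
  define d where "d = (\<lambda>x. q' x - q x)"
  have d_add: "d (x + y) = d x + d y" if "x \<in> V" "y \<in> V" for x y
    using quad_formsD [OF q that] quad_formsD [OF q' that] by (simp add: d_def)
  have "\<exists>c. d x = two_times c" if "x \<in> V" for x
  proof -
    have "0 \<in> V" "x + x = 0" using V that by (auto simp: F2_space_def)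
    then have "d x + d x = 0" using d_add [of x x] d_add [of 0 0] that by simp
    then show ?thesis by (metis two_torsion_Z4)
  qed
  then obtain l where l: "\<And>x. x \<in> V \<Longrightarrow> d x = two_times (l x)" by metis
  show thesis
  proof (rule that)
    show "q' x = q x + two_times (l x)" if "x \<in> V" for x
      using l [OF that] by (simp add: d_def algebra_simps)
    show "l (x + y) = l x + l y" if "x \<in> V" "y \<in> V" for x y
    proof -
      have "x + y \<in> V" using V that by (simp add: F2_space_def)
      then have "two_times (l (x + y)) = two_times (l x + l y)"
        using d_add [OF that] l [of "x + y"] l [of x] l [of y] that by (simp add: two_times_add)
      then show ?thesis by simp
    qed
  qed
qed

text \<open>
  Transitivity of the action is representability of linear forms by \<open>b\<close>, and freeness is
  nondegeneracy.
\<close>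

lemma affine_space_quad_forms:
  assumes V: "F2_space V" and ne: "quad_forms V b \<noteq> {}"
    and add_left: "\<And>x y z. x \<in> V \<Longrightarrow> y \<in> V \<Longrightarrow> z \<in> V \<Longrightarrow> b (x + y) z = b x z + b y z"
    and add_right: "\<And>x y z. x \<in> V \<Longrightarrow> y \<in> V \<Longrightarrow> z \<in> V \<Longrightarrow> b x (y + z) = b x y + b x z"
    and nondeg: "\<And>x. x \<in> V \<Longrightarrow> \<forall>y\<in>V. b x y = 0 \<Longrightarrow> x = 0"
    and represent: "\<And>l. (\<And>x y. x \<in> V \<Longrightarrow> y \<in> V \<Longrightarrow> l (x + y) = l x + l y) \<Longrightarrow>
      \<exists>v\<in>V. \<forall>x\<in>V. l x = b v x"
  shows "affine_space_over V (qf_act V b) (quad_forms V b)"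
  unfolding affine_space_over_def
proof (intro conjI ballI)
  have V_add: "x + y \<in> V" if "x \<in> V" "y \<in> V" for x y
    using V that by (simp add: F2_space_def)
  have zero: "0 \<in> V" using V by (simp add: F2_space_def)
  have b0: "b 0 x = 0" if "x \<in> V" for x
    using add_left [OF zero zero that] by simp
  show "F2_space V" "quad_forms V b \<noteq> {}" by fact+
  show "qf_act V b v q \<in> quad_forms V b" if "v \<in> V" "q \<in> quad_forms V b" for v q
    using that
    by (simp add: quad_forms_def qf_act_def V_add add_right two_times_add algebra_simps)
  show "qf_act V b 0 q = q" if "q \<in> quad_forms V b" for q
  proof
    show "qf_act V b 0 q x = q x" for x
      using quad_forms_outside [OF that, of x] by (cases "x \<in> V") (simp_all add: qf_act_def b0)
  qed
  show "qf_act V b (v + w) q = qf_act V b v (qf_act V b w q)" if "v \<in> V" "w \<in> V" for v w q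
  proof
    show "qf_act V b (v + w) q x = qf_act V b v (qf_act V b w q) x" for x
      using that by (simp add: qf_act_def add_left two_times_add algebra_simps)
  qed
  fix q q' assume q: "q \<in> quad_forms V b" and q': "q' \<in> quad_forms V b"
  obtain l where l: "\<And>x. x \<in> V \<Longrightarrow> q' x = q x + two_times (l x)"
    and "\<And>x y. x \<in> V \<Longrightarrow> y \<in> V \<Longrightarrow> l (x + y) = l x + l y"
    by (rule quad_forms_diff [OF V q q']) blast
  then obtain v where v: "v \<in> V" "\<forall>x\<in>V. l x = b v x" using represent by metis
  have act_eq: "qf_act V b w q = q' \<longleftrightarrow> (\<forall>x\<in>V. b w x = l x)" if "w \<in> V" for w
  proof -
    have "qf_act V b w q = q' \<longleftrightarrow> (\<forall>x\<in>V. q x + two_times (b w x) = q' x)"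
      using quad_forms_outside [OF q'] by (auto simp: qf_act_def fun_eq_iff)
    then show ?thesis by (simp add: l)
  qed
  show "\<exists>!v. v \<in> V \<and> qf_act V b v q = q'"
  proof (intro ex1I conjI)
    show "v \<in> V" "qf_act V b v q = q'" using v act_eq by auto
    fix w assume w: "w \<in> V \<and> qf_act V b w q = q'"
    then have "b w x = b v x" if "x \<in> V" for x
      using v act_eq [of w] that by simp
    then have "b (w + v) x = 0" if "x \<in> V" for x
      using v w that by (simp add: add_left bit_add_eq_0_iff)
    then have "w + v = 0" using nondeg V_add v w by blast
    moreover have "v + v = 0" using V v by (simp add: F2_space_def)
    ultimately show "w = v" by (metis add_right_imp_eq)
  qed
qed

text \<open>
  One step of the construction of a quadratic form.  On \<open>w + v\<close> the extension has to be
  \<open>q(w) + c + 2 b(w,v)\<close>, where \<open>c\<close> is its value at \<open>v\<close>.  The relation \<open>v + v = 0\<close> imposes only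
  \<open>2c + 2 b(v,v) = 0\<close>, which is solvable in \<open>\<int>/4\<close> even when \<open>b(v,v) = 1\<close>: this is where values in
  \<open>\<int>/4\<close> instead of \<open>\<int>/2\<close> matter, as \<open>b\<close> need not be alternating.
\<close>

lemma quad_form_extend:
  assumes W: "F2_space W" "W \<subseteq> V" and V: "F2_space V"
    and v: "v \<in> V" "v \<notin> W"
    and add_left: "\<And>x y z. x \<in> V \<Longrightarrow> y \<in> V \<Longrightarrow> z \<in> V \<Longrightarrow> b (x + y) z = b x z + b y z"
    and sym: "\<And>x y. x \<in> V \<Longrightarrow> y \<in> V \<Longrightarrow> b x y = b y x"
    and q: "q \<in> quad_forms W b"
  defines "W' \<equiv> W \<union> (\<lambda>w. w + v) ` W"
  shows "F2_space W'" and "quad_forms W' b \<noteq> {}"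
proof -
  have vv: "v + v = 0" using V v by (simp add: F2_space_def)
  have W_add: "x + y \<in> W" if "x \<in> W" "y \<in> W" for x y
    using W that by (simp add: F2_space_def)
  have W_dbl: "x + x = 0" if "x \<in> W" for x
    using W that by (simp add: F2_space_def)
  have swap: "(x + v) + (y + v) = x + y" for x y
    using vv by (metis add.assoc add.commute add.right_neutral)
  have zero: "0 \<in> W" using W by (simp add: F2_space_def)
  show "F2_space W'"
    unfolding F2_space_def
  proof (intro conjI ballI)
    show "0 \<in> W'" using zero by (simp add: W'_def)
    show "x + y \<in> W'" if "x \<in> W'" "y \<in> W'" for x y
    proof -
      have right: "w + (u + v) \<in> W'" and left: "(w + v) + u \<in> W'" if "w \<in> W" "u \<in> W" for w u
        using W_add [OF that] by (auto simp: W'_def image_iff add_ac)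
      show ?thesis
        using that left right by (auto simp: W'_def W_add swap)
    qed
    show "x + x = 0" if "x \<in> W'" for x
      using that by (auto simp: W'_def W_dbl swap)
  qed
  \<comment> \<open>The two cosets are disjoint, so a function on \<open>W'\<close> may be prescribed on each separately.\<close>
  have shift: "x + v \<notin> W" if "x \<in> W" for x
  proof
    assume "x + v \<in> W"
    then have "x + (x + v) \<in> W" using W_add that by blast
    then show False using W_dbl [OF that] v by (simp flip: add.assoc)
  qed
  have add_right: "b x (y + z) = b x y + b x z" if "x \<in> V" "y \<in> V" "z \<in> V" for x y z
    using add_left [OF that(2,3,1)] sym that V by (simp add: F2_space_def)
  define c :: 4 where "c = (if b v v = 0 then 0 else 1)"
  have c: "c + c + two_times (b v v) = 0" by (cases "b v v") (simp_all add: c_def)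
  define q' where "q' = restrict (\<lambda>x. if x \<in> W then q x
    else q (x + v) + c + two_times (b (x + v) v)) W'"
  have q'1: "q' x = q x" if "x \<in> W" for x
    using that by (simp add: q'_def W'_def)
  have q'2: "q' (x + v) = q x + c + two_times (b x v)" if "x \<in> W" for x
  proof -
    have cancel: "x + v + v = x" using vv by (simp add: add.assoc)
    show ?thesis using that shift [OF that] by (simp add: q'_def W'_def cancel)
  qed
  have "q' (x + y) = q' x + q' y + two_times (b x y)" if "x \<in> W'" "y \<in> W'" for x y
  proof -
    have WV: "w \<in> V" if "w \<in> W" for w using W that by blast
    have 1: "q' (w + u) = q' w + q' u + two_times (b w u)" if "w \<in> W" "u \<in> W" for w u
      using quad_formsD [OF q that] that by (simp add: q'1 W_add)
    have 2: "q' (w + (u + v)) = q' w + q' (u + v) + two_times (b w (u + v))"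
      if "w \<in> W" "u \<in> W" for w u
    proof -
      have "q' (w + (u + v)) = q (w + u) + c + two_times (b (w + u) v)"
        using q'2 [of "w + u"] W_add that by (simp add: add.assoc)
      then show ?thesis
        using quad_formsD [OF q that] that v
        by (simp add: q'1 q'2 add_left add_right WV two_times_add algebra_simps)
    qed
    have 3: "q' ((w + v) + (u + v)) = q' (w + v) + q' (u + v) + two_times (b (w + v) (u + v))"
      if "w \<in> W" "u \<in> W" for w u
    proof -
      have uv: "u + v \<in> V" "w + v \<in> V" using V that v WV by (auto simp: F2_space_def)
      have bb: "b (w + v) (u + v) = b w u + b w v + b u v + b v v"
        using uv that v WV sym [of v u] by (simp add: add_left add_right)
      have "q' (w + v) + q' (u + v) + two_times (b (w + v) (u + v))
          = q w + q u + two_times (b w u) + (two_times (b w v) + two_times (b w v))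
            + (two_times (b u v) + two_times (b u v)) + (c + c + two_times (b v v))"
        unfolding bb q'2 [OF \<open>w \<in> W\<close>] q'2 [OF \<open>u \<in> W\<close>] two_times_add
        by (simp only: ac_simps)
      also have "\<dots> = q' (w + u)"
        unfolding c two_times_double using quad_formsD [OF q that] that by (simp add: q'1 W_add)
      finally show ?thesis by (simp only: swap)
    qed
    consider (a) "x \<in> W" "y \<in> W" | (b) u where "x \<in> W" "u \<in> W" "y = u + v"
      | (c) u where "y \<in> W" "u \<in> W" "x = u + v"
      | (d) u w where "u \<in> W" "w \<in> W" "x = w + v" "y = u + v"
      using \<open>x \<in> W'\<close> \<open>y \<in> W'\<close> by (auto simp: W'_def)
    then show ?thesis
    proof cases
      case c
      then have "x \<in> V" "y \<in> V" using V v WV by (auto simp: F2_space_def)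
      then show ?thesis using 2 [of y u] c sym [of x y] by (simp add: ac_simps)
    qed (use 1 2 3 in auto)
  qed
  moreover have "q' \<in> extensional W'" by (simp add: q'_def)
  ultimately have "q' \<in> quad_forms W' b" by (simp add: quad_forms_def)
  then show "quad_forms W' b \<noteq> {}" by blast
qed

text \<open>
  A subspace that is maximal among those carrying a quadratic form is everything, since
  otherwise it could be enlarged by one more vector.
\<close>

lemma quad_forms_nonempty:
  assumes fin: "finite V" and V: "F2_space V"
    and add_left: "\<And>x y z. x \<in> V \<Longrightarrow> y \<in> V \<Longrightarrow> z \<in> V \<Longrightarrow> b (x + y) z = b x z + b y z"
    and sym: "\<And>x y. x \<in> V \<Longrightarrow> y \<in> V \<Longrightarrow> b x y = b y x"
  shows "quad_forms V b \<noteq> {}"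
proof -
  define C where "C = {W. F2_space W \<and> W \<subseteq> V \<and> quad_forms W b \<noteq> {}}"
  have zero: "0 \<in> V" using V by (simp add: F2_space_def)
  have "b 0 0 = 0" using add_left [OF zero zero zero] by simp
  then have "(\<lambda>x\<in>{0}. 0) \<in> quad_forms {0} b" by (simp add: quad_forms_def)
  then have "{0} \<in> C" using zero unfolding C_def by (auto simp: F2_space_def)
  moreover have "finite C"
    using fin by (auto simp: C_def intro: finite_subset [of _ "Pow V"])
  ultimately obtain W where W: "W \<in> C" and max: "\<And>U. U \<in> C \<Longrightarrow> W \<subseteq> U \<Longrightarrow> U = W"
    using finite_has_maximal2 [of C "{0}"] by metis
  have "W = V"
  proof (rule ccontr)
    assume "W \<noteq> V"
    then obtain v where v: "v \<in> V" "v \<notin> W" using W by (auto simp: C_def)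
    obtain q where q: "q \<in> quad_forms W b" using W by (auto simp: C_def)
    have FW: "F2_space W" "W \<subseteq> V" using W by (auto simp: C_def)
    let ?U = "W \<union> (\<lambda>w. w + v) ` W"
    have "F2_space ?U" "quad_forms ?U b \<noteq> {}"
      by (rule quad_form_extend [OF FW V v add_left sym q]; assumption)+
    moreover have "?U \<subseteq> V" using FW V v by (auto simp: F2_space_def)
    ultimately have "?U = W" by (intro max) (auto simp: C_def)
    moreover have "0 + v \<in> ?U" using FW by (intro UnI2 imageI) (simp add: F2_space_def)
    ultimately show False using v by simp
  qed
  then show ?thesis using W by (simp add: C_def)
qed

section \<open>Duality on \<open>A\<^sub>2\<close>\<close>

lemma mod2_double: "\<alpha> + \<alpha> = (0 :: 'a::ab_group_add mod2)"
proof -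
  obtain x where "\<alpha> = proj2 x" by (rule proj2_surj)
  moreover have "proj2 x + proj2 x = (0 :: 'a mod2)"
    by (metis cong2_def diff_0_right proj2_add proj2_eq_iff zero_mod2_def)
  ultimately show ?thesis by simp
qed

context gaussian_lattice
begin

lemma scale2_add: "scale2 scale c (\<alpha> + \<beta>) = scale2 scale c \<alpha> + scale2 scale c \<beta>"
proof -
  obtain x y where "\<alpha> = proj2 x" "\<beta> = proj2 y" by (metis proj2_surj)
  then show ?thesis
    by (simp only: scale2_proj scale_right_distrib flip: proj2_add)
qed

lemma eps_eq: "eps scale \<alpha> = \<alpha> + scale2 scale gi \<alpha>"
proof -
  obtain x where "\<alpha> = proj2 x" by (metis proj2_surj)
  then show ?thesis
    by (simp only: scale2_proj scale_left_distrib scale_one flip: proj2_add)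
qed

lemma form_e_sym: "form_e H \<alpha> \<beta> = form_e H \<beta> \<alpha>"
proof -
  obtain x y where "\<alpha> = proj2 x" "\<beta> = proj2 y" by (metis proj2_surj)
  moreover have "gim (H y x) = - gim (H x y)" by (metis hermitian gcnj_simps(2))
  ultimately show ?thesis by (simp add: form_e_proj form_E_def)
qed

lemma form_e_zero_left: "form_e H 0 \<beta> = 0"
  using form_e_add_left [of 0 0 \<beta>] by simp

lemma form_e_add_right: "form_e H \<gamma> (\<alpha> + \<beta>) = form_e H \<gamma> \<alpha> + form_e H \<gamma> \<beta>"
  using form_e_add_left form_e_sym by metis

text \<open>
  Over \<open>\<int>\<close> multiplication by \<open>i\<close> is skew-adjoint for \<open>E\<close>; the sign disappears modulo 2.
\<close>

lemma form_e_gi: "form_e H (scale2 scale gi \<alpha>) \<beta> = form_e H \<alpha> (scale2 scale gi \<beta>)"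
proof -
  obtain x y where "\<alpha> = proj2 x" "\<beta> = proj2 y" by (metis proj2_surj)
  then show ?thesis
    by (simp add: scale2_proj form_e_proj form_E_def H_scale_left scale_right)
qed

lemma form_e_eps: "form_e H (eps scale \<alpha>) \<beta> = form_e H \<alpha> (eps scale \<beta>)"
  by (simp add: eps_eq form_e_add_left form_e_add_right form_e_gi)

lemma eps_gi: "eps scale (scale2 scale gi \<alpha>) = eps scale \<alpha>"
proof -
  have "eps scale \<alpha> \<in> A_i scale" by (simp add: A_i_eq_range)
  then have "scale2 scale gi (eps scale \<alpha>) = eps scale \<alpha>" by (simp add: A_i_def)
  then show ?thesis by (simp only: eps_eq scale2_add)
qed

lemma form_Q_gi: "form_Q H (scale2 scale gi \<alpha>) = form_Q H \<alpha>"
proof -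
  obtain x where "\<alpha> = proj2 x" by (metis proj2_surj)
  then show ?thesis
    by (simp add: scale2_proj form_Q_proj form_S_def H_scale_left scale_right)
qed

text \<open>
  The polarisation of \<open>Q\<close> is \<open>2S\<close>, expressed here through \<open>S(x,y) = E(x,iy)\<close>.
\<close>

lemma form_Q_add:
  "form_Q H (\<alpha> + \<beta>) = form_Q H \<alpha> + form_Q H \<beta> + two_times (form_e H \<alpha> (scale2 scale gi \<beta>))"
proof -
  obtain x y where xy: "\<alpha> = proj2 x" "\<beta> = proj2 y" by (metis proj2_surj)
  have "gre (H y x) = gre (H x y)" by (metis hermitian gcnj_simps(1))
  then have "form_S H (x + y) (x + y)
      = form_S H x x + form_S H y y + 2 * form_E H x (scale gi y)"
    by (simp add: form_S_def form_E_def H_add_left add_right scale_right)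
  then show ?thesis
    unfolding xy scale2_proj proj2_add [symmetric] form_Q_proj form_e_proj two_times_of_int
    by (simp only: of_int_add)
qed

lemma A_i_F2_space: "F2_space (A_i scale)"
  using scale2_add [of gi 0 0]
  by (auto simp: F2_space_def mod2_double A_i_def scale2_add)

lemma module_int_scale: "Modules.module (int_scale scale)"
  by standard (simp_all add: int_scale_def scale_right_distrib scale_left_distrib)

lemma form_E_add_left: "form_E H (x + y) z = form_E H x z + form_E H y z"
  by (simp add: form_E_def H_add_left)

lemma form_E_add_right: "form_E H z (x + y) = form_E H z x + form_E H z y"
  by (simp add: form_E_def add_right)

lemma form_E_int_scale_left: "form_E H (int_scale scale n x) y = n * form_E H x y"
  by (simp add: form_E_def int_scale_def H_scale_left)

lemma form_E_int_scale_right: "form_E H x (int_scale scale n y) = n * form_E H x y"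
  by (simp add: form_E_def int_scale_def scale_right)

lemma form_E_zero: "form_E H 0 x = 0" "form_E H x 0 = 0"
  using form_E_add_left [of 0 0 x] form_E_add_right [of x 0 0] by simp_all

lemma form_E_sum_left: "form_E H (sum f A) y = (\<Sum>v\<in>A. form_E H (f v) y)"
  by (induction A rule: infinite_finite_induct) (simp_all add: form_E_zero form_E_add_left)

lemma form_E_sum_right: "form_E H x (sum f A) = (\<Sum>v\<in>A. form_E H x (f v))"
  by (induction A rule: infinite_finite_induct) (simp_all add: form_E_zero form_E_add_right)

text \<open>
  The coordinates of the dual vectors are the columns of the adjugate of the Gram matrix, which
  is its inverse because the determinant is 1.
\<close>

lemma dual_basis:
  assumes det1: "det (gram (form_E H) bs) = 1" and dist: "distinct bs"
  obtains d where "\<And>v w. v \<in> set bs \<Longrightarrow> w \<in> set bs \<Longrightarrow>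
    form_E H v (d w) = (if v = w then 1 else 0)"
proof -
  define n where "n = length bs"
  define A where "A = gram (form_E H) bs"
  define B where "B = adj_mat A"
  have A: "A \<in> carrier_mat n n" by (simp add: A_def gram_def n_def)
  have B: "B \<in> carrier_mat n n" "A * B = 1\<^sub>m n"
    using adj_mat [OF A] det1 by (auto simp: B_def A_def)
  define dv where "dv j = (\<Sum>m<n. int_scale scale (B $$ (m, j)) (bs ! m))" for j
  have dual: "form_E H (bs ! i) (dv j) = (if i = j then 1 else 0)" if "i < n" "j < n" for i j
  proof -
    have "form_E H (bs ! i) (dv j) = (\<Sum>m<n. A $$ (i, m) * B $$ (m, j))"
      using that by (simp add: dv_def form_E_sum_right form_E_int_scale_right A_def gram_def n_def
          mult.commute)
    also have "\<dots> = (A * B) $$ (i, j)"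
      using that A B(1) by (simp add: scalar_prod_def lessThan_atLeast0)
    finally show ?thesis using that by (simp add: B)
  qed
  define idx where "idx v = (SOME i. i < n \<and> bs ! i = v)" for v
  have idx: "idx v < n \<and> bs ! idx v = v" if "v \<in> set bs" for v
    unfolding idx_def by (rule someI_ex) (use that in \<open>auto simp: in_set_conv_nth n_def\<close>)
  show thesis
  proof
    fix v w assume "v \<in> set bs" "w \<in> set bs"
    then show "form_E H v (dv (idx w)) = (if v = w then 1 else 0)"
      using dual [of "idx v" "idx w"] idx by metis
  qed
qed

lemma basis_expansion:
  assumes "is_basis (int_scale scale) bs"
  obtains u where "x = (\<Sum>v\<in>set bs. int_scale scale (u v) v)"
proof -
  interpret Z: Modules.module "int_scale scale" by (rule module_int_scale)
  have "x \<in> Z.span (set bs)" using assms by (simp add: is_basis_def)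
  then show thesis using that by (auto simp: Z.span_finite)
qed

lemma proj2_int_scale: "proj2 (int_scale scale n x) = (if even n then 0 else proj2 x)"
proof -
  have dbl: "proj2 (int_scale scale (2 * k) y) = 0" for k y
  proof -
    have "int_scale scale (2 * k) y = int_scale scale k y + int_scale scale k y"
      by (simp add: int_scale_def flip: scale_left_distrib)
    then show ?thesis by (simp only: proj2_add mod2_double)
  qed
  show ?thesis
  proof (cases "even n")
    case True
    then show ?thesis using dbl by auto
  next
    case False
    then obtain k where "n = 2 * k + 1" by (rule oddE)
    then have "int_scale scale n x = int_scale scale (2 * k) x + x"
      by (simp add: int_scale_def scale_left_distrib)
    then show ?thesis using False dbl [of k x] by (simp add: proj2_add)
  qed
qed

lemma proj2_sum: "finite A \<Longrightarrow> (\<And>v. v \<in> A \<Longrightarrow> proj2 (f v) = 0) \<Longrightarrow> proj2 (sum f A) = 0"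
  by (induction A rule: finite_induct) (simp_all add: proj2_add flip: zero_mod2_def)

context
  assumes unimodular: "unimodular scale H"
begin

lemma unimodular_dual_basis:
  obtains bs d where "is_basis (int_scale scale) bs"
    and "\<And>v w. v \<in> set bs \<Longrightarrow> w \<in> set bs \<Longrightarrow> form_E H v (d w) = (if v = w then 1 else 0)"
  using unimodular dual_basis unfolding unimodular_def is_basis_def by metis

text \<open>
  Pairing with the dual basis reads off coordinates.  If they are all even, the vector lies in
  \<open>2\<Gamma>\<close>.  Separation gives nondegeneracy of \<open>e\<close>; finiteness of the separating set moreover gives
  finiteness of \<open>A\<^sub>2\<close>.
\<close>

lemma form_e_finite_separation:
  obtains D where "finite D" and "\<And>\<alpha>. \<forall>\<delta>\<in>D. form_e H \<alpha> \<delta> = 0 \<Longrightarrow> \<alpha> = 0"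
proof -
  obtain bs d where bs: "is_basis (int_scale scale) bs"
    and d: "\<And>v w. v \<in> set bs \<Longrightarrow> w \<in> set bs \<Longrightarrow> form_E H v (d w) = (if v = w then 1 else 0)"
    by (rule unimodular_dual_basis) blast
  show thesis
  proof
    show "finite ((\<lambda>v. proj2 (d v)) ` set bs)" by simp
    fix \<alpha>
    assume 0: "\<forall>\<delta>\<in>(\<lambda>v. proj2 (d v)) ` set bs. form_e H \<alpha> \<delta> = 0"
    obtain x where x: "\<alpha> = proj2 x" by (rule proj2_surj)
    obtain u where u: "x = (\<Sum>v\<in>set bs. int_scale scale (u v) v)"
      by (rule basis_expansion [OF bs])
    have "even (u w)" if "w \<in> set bs" for w
    proof -
      have "form_E H x (d w) = (\<Sum>v\<in>set bs. if v = w then u v else 0)"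
        unfolding u form_E_sum_left form_E_int_scale_left
        by (rule sum.cong) (simp_all add: d that)
      also have "\<dots> = u w" using that by simp
      finally have "form_e H \<alpha> (proj2 (d w)) = of_int (u w)" by (simp add: x form_e_proj)
      moreover have "form_e H \<alpha> (proj2 (d w)) = 0" using 0 that by blast
      ultimately show ?thesis by (cases "even (u w)") (auto elim: oddE)
    qed
    then show "\<alpha> = 0"
      unfolding x u by (intro proj2_sum) (simp_all add: proj2_int_scale)
  qed
qed

lemma form_e_nondegenerate:
  assumes "\<And>\<beta>. form_e H \<alpha> \<beta> = 0"
  shows "\<alpha> = 0"
  using form_e_finite_separation assms by metis

lemma finite_A2: "finite (UNIV :: 'a mod2 set)"
proof -
  obtain D where D: "finite D" "\<And>\<alpha>. \<forall>\<delta>\<in>D. form_e H \<alpha> \<delta> = 0 \<Longrightarrow> \<alpha> = 0"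
    by (rule form_e_finite_separation) blast
  define F where "F \<alpha> = {\<delta>\<in>D. form_e H \<alpha> \<delta> = 0}" for \<alpha>
  \<comment> \<open>An element of \<open>A\<^sub>2\<close> is determined by the elements of \<open>D\<close> that are orthogonal to it.\<close>
  have "inj F"
  proof (rule injI)
    fix \<alpha> \<beta> assume "F \<alpha> = F \<beta>"
    have "form_e H (\<alpha> + \<beta>) \<delta> = 0" if "\<delta> \<in> D" for \<delta>
    proof -
      have "form_e H \<alpha> \<delta> = 0 \<longleftrightarrow> form_e H \<beta> \<delta> = 0"
        using \<open>F \<alpha> = F \<beta>\<close> that by (auto simp: F_def)
      then show ?thesis
        by (cases "form_e H \<alpha> \<delta>") (simp_all add: form_e_add_left bit_add_eq_0_iff)
    qed
    then have "\<alpha> + \<beta> = 0" using D by blast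
    then show "\<alpha> = \<beta>" using mod2_double [of \<beta>] by (metis add_right_imp_eq)
  qed
  moreover have "range F \<subseteq> Pow D" by (auto simp: F_def)
  ultimately show ?thesis using D(1) by (meson finite_Pow_iff inj_on_finite)
qed

text \<open>
  The representing vector is the combination of dual basis vectors with coefficients the values
  of \<open>l\<close> on the basis, lifted to 0 or 1.
\<close>

lemma form_e_represents:
  fixes l :: "'a mod2 \<Rightarrow> bit"
  assumes l: "\<And>\<alpha> \<beta>. l (\<alpha> + \<beta>) = l \<alpha> + l \<beta>"
  obtains \<alpha> where "\<And>\<xi>. l \<xi> = form_e H \<alpha> \<xi>"
proof -
  obtain bs d where bs: "is_basis (int_scale scale) bs"
    and d: "\<And>v w. v \<in> set bs \<Longrightarrow> w \<in> set bs \<Longrightarrow> form_E H v (d w) = (if v = w then 1 else 0)"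
    by (rule unimodular_dual_basis) blast
  interpret Z: Modules.module "int_scale scale" by (rule module_int_scale)
  define c where "c v = (if l (proj2 v) = 0 then 0 else 1 :: int)" for v
  define a where "a = (\<Sum>v\<in>set bs. int_scale scale (c v) (d v))"
  \<comment> \<open>The discrepancy is additive and vanishes on the basis, hence everywhere.\<close>
  define m where "m \<xi> = l \<xi> + form_e H \<xi> (proj2 a)" for \<xi>
  have m_add: "m (\<xi> + \<eta>) = m \<xi> + m \<eta>" for \<xi> \<eta>
    by (simp add: m_def l form_e_add_left)
  then have m0: "m 0 = 0" by (metis add_0_left add_right_cancel)
  have m_basis: "m (proj2 v) = 0" if "v \<in> set bs" for v
  proof -
    have "form_E H v a = (\<Sum>w\<in>set bs. if v = w then c w else 0)"
      unfolding a_def form_E_sum_right form_E_int_scale_right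
      by (rule sum.cong) (simp_all add: d that)
    also have "\<dots> = c v" using that by simp
    finally show ?thesis by (cases "l (proj2 v)") (simp_all add: m_def form_e_proj c_def)
  qed
  have m_zero: "m (proj2 x) = 0" for x
  proof -
    have "x \<in> Z.span (set bs)" using bs by (simp add: is_basis_def)
    then show ?thesis
    proof (induction rule: Z.span_induct_alt)
      case base
      then show ?case using m0 by (simp add: zero_mod2_def)
    next
      case (step n v y)
      then show ?case by (simp add: proj2_add m_add proj2_int_scale m_basis m0)
    qed
  qed
  show thesis
  proof
    fix \<xi> :: "'a mod2"
    obtain x where "\<xi> = proj2 x" by (rule proj2_surj)
    then have "l \<xi> + form_e H (proj2 a) \<xi> = 0"
      using m_zero [of x] form_e_sym [of \<xi>] by (simp add: m_def)
    then show "l \<xi> = form_e H (proj2 a) \<xi>" by (simp add: bit_add_eq_0_iff)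
  qed
qed

section \<open>The form \<open>b\<close> on \<open>A\<^sub>i\<close>\<close>

lemma A_iE:
  assumes "x \<in> A_i scale"
  obtains \<alpha> where "x = eps scale \<alpha>"
  using assms by (auto simp: A_i_eq_range)

lemma form_b_add_left:
  assumes "x \<in> A_i scale" "y \<in> A_i scale" "z \<in> A_i scale"
  shows "form_b scale H (x + y) z = form_b scale H x z + form_b scale H y z"
proof -
  obtain \<alpha> \<beta> \<gamma> where "x = eps scale \<alpha>" "y = eps scale \<beta>" "z = eps scale \<gamma>"
    using assms by (metis A_iE)
  then show ?thesis by (simp only: form_b_eps form_e_add_left flip: scale2_add)
qed

lemma form_b_sym:
  assumes "x \<in> A_i scale" "y \<in> A_i scale"
  shows "form_b scale H x y = form_b scale H y x"
proof -
  obtain \<alpha> \<beta> where "x = eps scale \<alpha>" "y = eps scale \<beta>"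
    using assms by (metis A_iE)
  then show ?thesis
    using form_e_eps [of \<alpha> \<beta>] form_e_sym [of "eps scale \<alpha>" \<beta>] by (simp only: form_b_eps)
qed

lemma form_b_add_right:
  assumes "x \<in> A_i scale" "y \<in> A_i scale" "z \<in> A_i scale"
  shows "form_b scale H x (y + z) = form_b scale H x y + form_b scale H x z"
proof -
  have "y + z \<in> A_i scale" using A_i_F2_space assms by (simp add: F2_space_def)
  then show ?thesis
    using form_b_add_left [OF assms(2,3,1)] form_b_sym assms by metis
qed

text \<open>
  The mixed description of \<open>b\<close>, with only the second argument divided by \<open>\<epsilon>\<close>.  It reduces all
  duality statements for \<open>b\<close> to those for \<open>e\<close>.
\<close>

lemma form_b_eps_right:
  assumes "\<alpha> \<in> A_i scale"
  shows "form_b scale H \<alpha> (eps scale \<xi>) = form_e H \<alpha> \<xi>"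
proof -
  obtain \<beta> where "\<alpha> = eps scale \<beta>" using assms by (rule A_iE)
  then show ?thesis by (simp only: form_b_eps form_e_eps)
qed

lemma form_b_nondegenerate:
  assumes x: "x \<in> A_i scale" and 0: "\<forall>y\<in>A_i scale. form_b scale H x y = 0"
  shows "x = 0"
proof (rule form_e_nondegenerate)
  fix \<xi>
  have "eps scale \<xi> \<in> A_i scale" by (simp add: A_i_eq_range)
  then show "form_e H x \<xi> = 0" using 0 form_b_eps_right [OF x] by metis
qed

text \<open>
  The form \<open>l \<circ> \<epsilon>\<close> on \<open>A\<^sub>2\<close> is \<open>e(\<beta>,-)\<close> for some \<open>\<beta>\<close>.  It vanishes on \<open>A\<^sub>i = Ker \<epsilon>\<close>, that is,
  \<open>e(\<epsilon>\<beta>,-) = e(\<beta>,\<epsilon>-) = 0\<close>, so that \<open>\<beta>\<close> lies in \<open>A\<^sub>i\<close>; and then \<open>l = b(\<beta>,-)\<close>.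
\<close>

lemma form_b_represents:
  fixes l :: "'a mod2 \<Rightarrow> bit"
  assumes l: "\<And>x y. x \<in> A_i scale \<Longrightarrow> y \<in> A_i scale \<Longrightarrow> l (x + y) = l x + l y"
  shows "\<exists>v\<in>A_i scale. \<forall>x\<in>A_i scale. l x = form_b scale H v x"
proof -
  have eps_mem: "eps scale \<xi> \<in> A_i scale" for \<xi> by (simp add: A_i_eq_range)
  have "l (eps scale (\<xi> + \<eta>)) = l (eps scale \<xi>) + l (eps scale \<eta>)" for \<xi> \<eta>
    by (simp add: scale2_add l eps_mem)
  then obtain \<beta> where \<beta>: "\<And>\<xi>. l (eps scale \<xi>) = form_e H \<beta> \<xi>"
    by (rule form_e_represents [of "\<lambda>\<xi>. l (eps scale \<xi>)"]) blast
  have "eps scale \<beta> = 0"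
  proof (rule form_e_nondegenerate)
    fix \<xi>
    have "eps scale (eps scale \<xi>) = 0" "eps scale 0 = 0"
      using eps_mem [of \<xi>] scale2_add [of "1 + gi" 0 0] by (auto simp: A_i_eq_ker)
    moreover have "l 0 = 0" using l [of 0 0] A_i_F2_space by (simp add: F2_space_def)
    ultimately show "form_e H (eps scale \<beta>) \<xi> = 0"
      using \<beta> [of "eps scale \<xi>"] by (simp add: form_e_eps)
  qed
  then have "\<beta> \<in> A_i scale" by (simp add: A_i_eq_ker)
  moreover have "l x = form_b scale H \<beta> x" if "x \<in> A_i scale" for x
    using that \<beta> form_b_eps_right [OF \<open>\<beta> \<in> A_i scale\<close>] by (auto elim: A_iE)
  ultimately show ?thesis by blast
qed

lemma affine_space_Q_b:
  "affine_space_over (A_i scale) (qf_act (A_i scale) (form_b scale H))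
    (quad_forms (A_i scale) (form_b scale H))"
proof (rule affine_space_quad_forms [OF A_i_F2_space])
  show "quad_forms (A_i scale) (form_b scale H) \<noteq> {}"
    by (rule quad_forms_nonempty [OF finite_subset [OF subset_UNIV finite_A2] A_i_F2_space
          form_b_add_left form_b_sym])
  show "form_b scale H (x + y) z = form_b scale H x z + form_b scale H y z"
    if "x \<in> A_i scale" "y \<in> A_i scale" "z \<in> A_i scale" for x y z
    using that by (rule form_b_add_left)
  show "form_b scale H x (y + z) = form_b scale H x y + form_b scale H x z"
    if "x \<in> A_i scale" "y \<in> A_i scale" "z \<in> A_i scale" for x y z
    using that by (rule form_b_add_right)
  show "x = 0" if "x \<in> A_i scale" "\<forall>y\<in>A_i scale. form_b scale H x y = 0" for x
    using that by (rule form_b_nondegenerate)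
  show "\<exists>v\<in>A_i scale. \<forall>x\<in>A_i scale. l x = form_b scale H v x"
    if "\<And>x y. x \<in> A_i scale \<Longrightarrow> y \<in> A_i scale \<Longrightarrow> l (x + y) = l x + l y" for l
    using that by (rule form_b_represents)
qed

section \<open>The map \<open>q \<mapsto> Q\<^sub>q\<close>\<close>

text \<open>
  This is \<open>\<epsilon> = 1 + i\<close>, arranged so that the last summand cancels against the polarisation of \<open>Q\<close>.
\<close>

lemma two_times_form_e:
  "two_times (form_e H \<alpha> \<beta>) = two_times (form_e H \<alpha> (eps scale \<beta>))
     + two_times (form_e H \<alpha> (scale2 scale gi \<beta>))"
  by (simp add: eps_eq form_e_add_right two_times_add add.assoc)

lemma Q_of_quad_form:
  assumes q: "q \<in> inv_quad_forms scale H"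
  shows "Q_of scale H q \<in> quad_forms (A_i scale) (form_b scale H)"
proof -
  have "q (\<alpha> + \<beta>) = q \<alpha> + q \<beta> + two_times (form_e H \<alpha> \<beta>)" for \<alpha> \<beta>
    using q by (auto simp: inv_quad_forms_def quad_forms_def)
  then have "Q_of scale H q (eps scale (\<alpha> + \<beta>)) = Q_of scale H q (eps scale \<alpha>)
      + Q_of scale H q (eps scale \<beta>) + two_times (form_b scale H (eps scale \<alpha>) (eps scale \<beta>))"
    for \<alpha> \<beta>
    by (simp add: Q_of_eps [OF q] form_Q_add form_b_eps two_times_form_e [of \<alpha> \<beta>])
  then have "Q_of scale H q (x + y) = Q_of scale H q x
      + Q_of scale H q y + two_times (form_b scale H x y)"
    if "x \<in> A_i scale" "y \<in> A_i scale" for x y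
    using that by (elim A_iE) (simp only: scale2_add)
  then show ?thesis by (simp add: quad_forms_def Q_of_def)
qed

text \<open>
  Solving \<open>Q\<^sub>q = p\<close> for \<open>q\<close>.  The result is \<open>i\<close>-invariant because \<open>\<epsilon>i = \<epsilon>\<close> on \<open>A\<^sub>2\<close> and \<open>Q\<close> is
  \<open>i\<close>-invariant.
\<close>

lemma inv_quad_forms_nonempty: "inv_quad_forms scale H \<noteq> {}"
proof -
  obtain p where p: "p \<in> quad_forms (A_i scale) (form_b scale H)"
    using affine_space_Q_b by (auto simp: affine_space_over_def)
  define q where "q \<alpha> = p (eps scale \<alpha>) + form_Q H \<alpha>" for \<alpha>
  have "p (eps scale \<alpha> + eps scale \<beta>) = p (eps scale \<alpha>) + p (eps scale \<beta>)
      + two_times (form_b scale H (eps scale \<alpha>) (eps scale \<beta>))" for \<alpha> \<beta>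
    using p by (rule quad_formsD) (simp_all add: A_i_eq_range)
  then have "q (\<alpha> + \<beta>) = q \<alpha> + q \<beta> + two_times (form_e H \<alpha> \<beta>)" for \<alpha> \<beta>
    by (simp add: q_def scale2_add form_Q_add form_b_eps two_times_form_e [of \<alpha> \<beta>])
  moreover have "q (scale2 scale gi \<alpha>) = q \<alpha>" for \<alpha>
    by (simp add: q_def eps_gi form_Q_gi)
  ultimately have "q \<in> inv_quad_forms scale H"
    by (simp add: inv_quad_forms_def quad_forms_def)
  then show ?thesis by blast
qed

lemma affine_space_Q_e:
  "affine_space_over UNIV (qf_act UNIV (form_e H)) (quad_forms UNIV (form_e H))"
proof (rule affine_space_quad_forms)
  show "quad_forms UNIV (form_e H) \<noteq> {}"
    using inv_quad_forms_nonempty by (auto simp: inv_quad_forms_def)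
  show "\<exists>v\<in>UNIV. \<forall>x\<in>UNIV. l x = form_e H v x"
    if "\<And>x y. x \<in> UNIV \<Longrightarrow> y \<in> UNIV \<Longrightarrow> l (x + y) = l x + l y" for l
  proof -
    have "l (\<alpha> + \<beta>) = l \<alpha> + l \<beta>" for \<alpha> \<beta> using that by simp
    then obtain \<alpha> where "\<And>\<xi>. l \<xi> = form_e H \<alpha> \<xi>" by (rule form_e_represents) blast
    then show ?thesis by blast
  qed
  show "x = 0" if "\<forall>y\<in>UNIV. form_e H x y = 0" for x
    by (rule form_e_nondegenerate) (use that in blast)
qed (simp_all add: F2_space_def mod2_double form_e_add_left form_e_add_right)

lemma inv_quad_forms_act_iff:
  assumes q: "q \<in> inv_quad_forms scale H"
  shows "qf_act UNIV (form_e H) \<alpha> q \<in> inv_quad_forms scale H \<longleftrightarrow> \<alpha> \<in> A_i scale"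
proof -
  have act: "qf_act UNIV (form_e H) \<alpha> q \<in> quad_forms UNIV (form_e H)"
    using q affine_space_Q_e by (auto simp: affine_space_over_def inv_quad_forms_def)
  have "qf_act UNIV (form_e H) \<alpha> q \<in> inv_quad_forms scale H
      \<longleftrightarrow> (\<forall>\<xi>. form_e H (scale2 scale gi \<alpha>) \<xi> = form_e H \<alpha> \<xi>)"
    using q act by (simp add: inv_quad_forms_def qf_act_def form_e_gi)
  also have "\<dots> \<longleftrightarrow> (\<forall>\<xi>. form_e H (eps scale \<alpha>) \<xi> = 0)"
    by (simp add: eps_eq form_e_add_left bit_add_eq_0_iff eq_commute [of "form_e H \<alpha> _"])
  also have "\<dots> \<longleftrightarrow> eps scale \<alpha> = 0"
    using form_e_nondegenerate form_e_zero_left by metis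
  finally show ?thesis by (simp add: A_i_eq_ker)
qed

lemma affine_space_inv_quad_forms:
  "affine_space_over (A_i scale) (qf_act UNIV (form_e H)) (inv_quad_forms scale H)"
proof (rule affine_subspace [OF affine_space_Q_e A_i_F2_space])
  show "inv_quad_forms scale H \<subseteq> quad_forms UNIV (form_e H)"
    by (auto simp: inv_quad_forms_def)
qed (simp_all add: inv_quad_forms_nonempty inv_quad_forms_act_iff)

lemma Q_of_act:
  assumes \<alpha>: "\<alpha> \<in> A_i scale" and q: "q \<in> inv_quad_forms scale H"
  shows "Q_of scale H (qf_act UNIV (form_e H) \<alpha> q)
    = qf_act (A_i scale) (form_b scale H) \<alpha> (Q_of scale H q)"
proof
  fix x
  have q': "qf_act UNIV (form_e H) \<alpha> q \<in> inv_quad_forms scale H"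
    using inv_quad_forms_act_iff [OF q] \<alpha> by simp
  show "Q_of scale H (qf_act UNIV (form_e H) \<alpha> q) x
    = qf_act (A_i scale) (form_b scale H) \<alpha> (Q_of scale H q) x"
  proof (cases "x \<in> A_i scale")
    case True
    then obtain \<xi> where x: "x = eps scale \<xi>" by (rule A_iE)
    have "qf_act (A_i scale) (form_b scale H) \<alpha> (Q_of scale H q) x
        = Q_of scale H q x + two_times (form_b scale H \<alpha> x)"
      using True by (simp add: qf_act_def)
    then show ?thesis
      by (simp add: x Q_of_eps [OF q] Q_of_eps [OF q'] form_b_eps_right [OF \<alpha>])
        (simp add: qf_act_def)
  qed (simp add: Q_of_def qf_act_def)
qed

end

end

theorem lemma2:
  fixes scale :: "gint \<Rightarrow> 'a::ab_group_add \<Rightarrow> 'a"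
    and H :: "'a \<Rightarrow> 'a \<Rightarrow> gint"
    and g :: nat
  assumes lattice: "gaussian_lattice scale H"
    and rank: "has_int_rank scale (2 * g)"
    and unimod: "unimodular scale H"
  shows "affine_iso_over (A_i scale)
           (qf_act UNIV (form_e H)) (inv_quad_forms scale H)
           (qf_act (A_i scale) (form_b scale H)) (quad_forms (A_i scale) (form_b scale H))
           (Q_of scale H)"
proof -
  interpret gaussian_lattice scale H by (rule lattice)
  show ?thesis
    using unimod by (intro affine_iso_over_equivariant affine_space_inv_quad_forms
        affine_space_Q_b Q_of_quad_form Q_of_act)
qed

end
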